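(* The numerical dispersion relations of the modified BDF schemes M-BDF$s$, $s=2,3,4,5,6$, for the cubic nonlinear Schrödinger equation $iu_t+\Delta u=\lambda|u|^2u$ are given by $$ \frac{2}{\tau}\sin(\tilde\omega\tau/2)=\bigl(k^2+\lambda H(\tilde\omega,\tau)\bigr)\cos(\tilde\omega\tau/2), $$ where $H(\tilde\omega,\tau)$ is as follows. M-BDF2: $H=-\frac12\bigl[3\cos(\tilde\omega\tau)-5\bigr]$; M-BDF3: $H=-\frac1{36}\bigl[47\cos(2\tilde\omega\tau)-83\bigr]$; M-BDF4: $H=-\frac1{72}\bigl[913\cos(\tilde\omega\tau)-394\cos(2\tilde\omega\tau)+75\cos(3\tilde\omega\tau)-666\bigr]$; M-BDF5: $H=-\frac1{1800}\bigl[54049\cos(\tilde\omega\tau)-30682\cos(2\tilde\omega\tau)+10587\cos(3\tilde\omega\tau)-1644\cos(4\tilde\omega\tau)-34110\bigr]$; M-BDF6: $H=-\frac1{1800}\bigl[131149\cos(\tilde\omega\tau)-85882\cos(2\tilde\omega\tau)+39537\cos(3\tilde\omega\tau)-11244\cos(4\tilde\omega\tau)+1470\cos(5\tilde\omega\tau)-76830\bigr]$.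
   Context: Here $\lambda=\pm1$, $i=\sqrt{-1}$, $\tau>0$ is the time step and $u^n$ approximates $u$ at time $n\tau$. The modified $s$-step BDF scheme M-BDF$s$ is $$ \frac{i}{\tau}(R^{n+1}-R^n)=-\Delta R^{n+1/2}+\frac{\lambda}{2}\bigl(|R^{n+1}|^2+|R^n|^2\bigr)R^{n+1/2},\qquad R^n=\sum_{j=0}^{s-1}\beta_{s,j}u^{n-j},\quad R^{n+1/2}=\frac{R^{n+1}+R^n}{2}, $$ with coefficients $(\beta_{s,0},\dots,\beta_{s,s-1})$: $s=2$: $(\frac32,-\frac12)$; $s=3$: $(\frac{11}6,-\frac76,\frac13)$; $s=4$: $(\frac{25}{12},-\frac{23}{12},\frac{13}{12},-\frac14)$; $s=5$: $(\frac{137}{60},-\frac{163}{60},\frac{137}{60},-\frac{21}{20},\frac15)$; $s=6$: $(\frac{147}{60},-\frac{213}{60},\frac{237}{60},-\frac{163}{60},\frac{31}{30},-\frac16)$. The numerical dispersion relation of a time-stepping scheme is the relation between the wave number $k$ and the numerical angular frequency $\tilde\omega$ obtained by substituting the discrete plane wave solution $u^n=e^{i(kx-\tilde\omega n\tau)}$ into the scheme.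
   Formalization: The printed M-BDF3 formula is false for the given coefficients (e.g. λ=-1, τ=1, ω̃=π/3, k²=2tan(π/6)+61/36); the formal statement uses H = -(1/18)[91cos(ω̃τ) - 22cos(2ω̃τ) - 87] instead. *)

theory Defs
  imports "HOL-Analysis.Analysis"
begin

definition partial_deriv :: "'a::euclidean_space \<Rightarrow> ('a \<Rightarrow> complex) \<Rightarrow> 'a \<Rightarrow> complex" where
  "partial_deriv b f x = vector_derivative (\<lambda>t. f (x + t *\<^sub>R b)) (at 0)"

(* The value is meaningful for twice differentiable f; below it is applied to plane waves. *)
definition laplacian :: "('a::euclidean_space \<Rightarrow> complex) \<Rightarrow> 'a \<Rightarrow> complex" where
  "laplacian f x = (\<Sum>b\<in>Basis. partial_deriv b (partial_deriv b f) x)"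

definition mbdf_coeffs :: "nat \<Rightarrow> real list" where
  "mbdf_coeffs s =
    (if s = 2 then [3/2, -1/2]
     else if s = 3 then [11/6, -7/6, 1/3]
     else if s = 4 then [25/12, -23/12, 13/12, -1/4]
     else if s = 5 then [137/60, -163/60, 137/60, -21/20, 1/5]
     else if s = 6 then [147/60, -213/60, 237/60, -163/60, 31/30, -1/6]
     else [])"

(* R^n; only used for n >= s - 1, so that the subtraction n - j does not truncate. *)
definition mbdf_R :: "nat \<Rightarrow> (nat \<Rightarrow> 'a \<Rightarrow> complex) \<Rightarrow> nat \<Rightarrow> 'a \<Rightarrow> complex" where
  "mbdf_R s u n x = (\<Sum>j<s. complex_of_real (mbdf_coeffs s ! j) * u (n - j) x)"

definition mbdf_R_half ::
    "nat \<Rightarrow> (nat \<Rightarrow> 'a \<Rightarrow> complex) \<Rightarrow> nat \<Rightarrow> 'a \<Rightarrow> complex" where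
  "mbdf_R_half s u n x = (mbdf_R s u (Suc n) x + mbdf_R s u n x) / 2"

(* u solves M-BDFs with time step \<tau>: the first admissible n is s - 1, because R^n involves
   u^(n-s+1), ..., u^n. *)
definition mbdf_scheme ::
    "real \<Rightarrow> nat \<Rightarrow> real \<Rightarrow> (nat \<Rightarrow> 'a::euclidean_space \<Rightarrow> complex) \<Rightarrow> bool" where
  "mbdf_scheme lam s \<tau> u \<longleftrightarrow>
    (\<forall>n x. s - 1 \<le> n \<longrightarrow>
      \<i> / complex_of_real \<tau> * (mbdf_R s u (Suc n) x - mbdf_R s u n x)
      = - laplacian (mbdf_R_half s u n) x
        + complex_of_real (lam / 2 * ((cmod (mbdf_R s u (Suc n) x))\<^sup>2 + (cmod (mbdf_R s u n x))\<^sup>2))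
          * mbdf_R_half s u n x)"

definition discrete_plane_wave ::
    "'a::euclidean_space \<Rightarrow> real \<Rightarrow> real \<Rightarrow> nat \<Rightarrow> 'a \<Rightarrow> complex" where
  "discrete_plane_wave k \<omega> \<tau> n x = exp (\<i> * complex_of_real (k \<bullet> x - \<omega> * real n * \<tau>))"

(* The first argument is a time-stepping scheme: a predicate on the time step and the sequence
   of time levels. *)
definition numerical_dispersion_relation ::
    "(real \<Rightarrow> (nat \<Rightarrow> 'a::euclidean_space \<Rightarrow> complex) \<Rightarrow> bool) \<Rightarrow> real \<Rightarrow> ('a \<times> real) set" where
  "numerical_dispersion_relation scheme \<tau> =
    {(k, \<omega>). scheme \<tau> (discrete_plane_wave k \<omega> \<tau>)}"

(* For s = 3 the formula printed in the source, -(1/36) (47 cos(2\<omega>\<tau>) - 83), is a misprint: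
   substituting the plane wave gives |11/6 - 7/6 e^(i\<omega>\<tau>) + 1/3 e^(2i\<omega>\<tau>)|^2, which is the
   expression below. With the printed one the relation fails, e.g. for the focusing sign -1, \<tau> = 1,
   \<omega> = \<pi>/3 and the k with k^2 = 2 tan(\<pi>/6) + 61/36, a plane wave that does solve the scheme. *)
definition mbdf_H :: "nat \<Rightarrow> real \<Rightarrow> real \<Rightarrow> real" where
  "mbdf_H s \<omega> \<tau> =
    (if s = 2 then - (1/2) * (3 * cos (\<omega> * \<tau>) - 5)
     else if s = 3 then - (1/18) * (91 * cos (\<omega> * \<tau>) - 22 * cos (2 * \<omega> * \<tau>) - 87)
     else if s = 4 then - (1/72) * (913 * cos (\<omega> * \<tau>) - 394 * cos (2 * \<omega> * \<tau>)
                                    + 75 * cos (3 * \<omega> * \<tau>) - 666)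
     else if s = 5 then - (1/1800) * (54049 * cos (\<omega> * \<tau>) - 30682 * cos (2 * \<omega> * \<tau>)
                                    + 10587 * cos (3 * \<omega> * \<tau>) - 1644 * cos (4 * \<omega> * \<tau>) - 34110)
     else if s = 6 then - (1/1800) * (131149 * cos (\<omega> * \<tau>) - 85882 * cos (2 * \<omega> * \<tau>)
                                    + 39537 * cos (3 * \<omega> * \<tau>) - 11244 * cos (4 * \<omega> * \<tau>)
                                    + 1470 * cos (5 * \<omega> * \<tau>) - 76830)
     else 0)"

end

theory Submission
  imports Defs
begin

text \<open>
  A plane wave is an eigenfunction of everything linear in the scheme. With \<open>\<theta> = \<omega> \<tau>\<close>, shifting the
  wave back by \<open>j\<close> time levels multiplies it by \<open>cis (j \<theta>)\<close>, so that \<open>R\<^sup>n = P(\<theta>) u\<^sup>n\<close> with the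
  trigonometric polynomial \<open>P(\<theta>) = \<Sum>j<s. \<beta>\<^sub>j cis (j \<theta>)\<close>, the symbol of the averaging operator; and
  \<open>- \<Delta>\<close> acts as \<open>|k|\<^sup>2\<close>. Since \<open>|u\<^sup>n| = 1\<close>, the nonlinear coefficient is the constant
  \<open>lam |P|\<^sup>2\<close>. Every equation of the scheme therefore carries the same factor
  \<open>P(\<theta>) u\<^sup>n\<close>, and if this is nonzero, dividing by it leaves
  \<open>\<i>/\<tau> (cis (- \<theta>) - 1) = (|k|\<^sup>2 + lam |P|\<^sup>2) (cis (- \<theta>) + 1) / 2\<close>.
  Multiplying by \<open>cis (\<theta>/2)\<close> turns the two brackets into multiples of \<open>sin (\<theta>/2)\<close> and
  \<open>cos (\<theta>/2)\<close>, which gives the asserted relation with \<open>H = |P|\<^sup>2\<close>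
  (\<open>plane_wave_solves_mbdf_iff\<close>).

  Two facts about the coefficients remain. The first is that \<open>|P|\<^sup>2\<close> is the explicit cosine polynomial
  \<open>mbdf_H\<close>: the coefficient of \<open>cos (m \<theta>)\<close> is the lag-\<open>m\<close> autocorrelation of \<open>\<beta>\<close>, doubled for
  \<open>m > 0\<close> (\<open>cmod_trigonometric_sum_squared\<close>, \<open>mbdf_H_eq_cmod_symbol_squared\<close>). The second is
  that \<open>P\<close> never vanishes. At a zero of \<open>P\<close> the plane wave would solve the scheme trivially for every
  \<open>k\<close>, and the equality of the two sets would break down. It is excluded by \<open>mbdf_H_pos\<close>, which
  writes \<open>H\<close> as a polynomial in \<open>y = 1 - cos \<theta> \<ge> 0\<close> that is visibly positive.
\<close>

section \<open>The Laplacian on plane waves\<close>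

text \<open>
  The amplitude \<open>C\<close> is arbitrary so that the result is again of the shape on the left and the rule can
  be applied twice, as the Laplacian requires.
\<close>

lemma partial_deriv_plane_wave:
  fixes k b :: "'a::euclidean_space"
  shows "partial_deriv b (\<lambda>x. C * exp (\<i> * complex_of_real (k \<bullet> x))) =
    (\<lambda>x. \<i> * complex_of_real (k \<bullet> b) * C * exp (\<i> * complex_of_real (k \<bullet> x)))"
proof
  fix x
  have "((\<lambda>t::real. C * exp (\<i> * complex_of_real (k \<bullet> x + t * (k \<bullet> b)))) has_vector_derivative
      \<i> * complex_of_real (k \<bullet> b) * C * exp (\<i> * complex_of_real (k \<bullet> x))) (at 0)"
  proof -
    have "((\<lambda>z. C * exp (\<i> * (complex_of_real (k \<bullet> x) + z * complex_of_real (k \<bullet> b))))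
        has_field_derivative \<i> * complex_of_real (k \<bullet> b) * C * exp (\<i> * complex_of_real (k \<bullet> x)))
        (at (complex_of_real 0))"
      by (auto intro!: derivative_eq_intros)
    from has_vector_derivative_real_field[OF this] show ?thesis by (simp add: o_def)
  qed
  then show "partial_deriv b (\<lambda>x. C * exp (\<i> * complex_of_real (k \<bullet> x))) x =
      \<i> * complex_of_real (k \<bullet> b) * C * exp (\<i> * complex_of_real (k \<bullet> x))"
    unfolding partial_deriv_def
    by (intro vector_derivative_at) (simp add: inner_add_right)
qed

lemma laplacian_plane_wave:
  fixes k :: "'a::euclidean_space"
  shows "laplacian (\<lambda>x. C * exp (\<i> * complex_of_real (k \<bullet> x))) x =
    - complex_of_real ((norm k)\<^sup>2) * (C * exp (\<i> * complex_of_real (k \<bullet> x)))"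
proof -
  let ?f = "C * exp (\<i> * complex_of_real (k \<bullet> x))"
  have "laplacian (\<lambda>x. C * exp (\<i> * complex_of_real (k \<bullet> x))) x =
      (\<Sum>b\<in>Basis. - (complex_of_real ((k \<bullet> b) * (k \<bullet> b)) * ?f))"
    unfolding laplacian_def partial_deriv_plane_wave
    by (intro sum.cong refl) (simp add: algebra_simps)
  also have "\<dots> = - (complex_of_real (\<Sum>b\<in>Basis. (k \<bullet> b) * (k \<bullet> b)) * ?f)"
    by (simp only: sum_negf of_real_sum sum_distrib_right)
  also have "(\<Sum>b\<in>Basis. (k \<bullet> b) * (k \<bullet> b)) = (norm k)\<^sup>2"
    by (metis euclidean_inner power2_norm_eq_inner)
  finally show ?thesis by simp
qed

section \<open>The symbol of the averaging operator\<close>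

definition mbdf_symbol :: "nat \<Rightarrow> real \<Rightarrow> complex" where
  "mbdf_symbol s \<theta> = (\<Sum>j<s. complex_of_real (mbdf_coeffs s ! j) * cis (real j * \<theta>))"

lemma mbdf_R_plane_wave:
  assumes "s - 1 \<le> n"
  shows "mbdf_R s (discrete_plane_wave k \<omega> \<tau>) n x =
    mbdf_symbol s (\<omega> * \<tau>) * cis (- (real n * (\<omega> * \<tau>))) * exp (\<i> * complex_of_real (k \<bullet> x))"
proof -
  have "discrete_plane_wave k \<omega> \<tau> (n - j) x =
      cis (real j * (\<omega> * \<tau>)) * (cis (- (real n * (\<omega> * \<tau>))) * exp (\<i> * complex_of_real (k \<bullet> x)))"
    if "j < s" for j
  proof -
    have "real (n - j) = real n - real j"
      using that assms by (simp add: of_nat_diff)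
    then show ?thesis
      by (simp add: discrete_plane_wave_def cis_conv_exp exp_add[symmetric] algebra_simps)
  qed
  then show ?thesis
    by (simp add: mbdf_R_def mbdf_symbol_def sum_distrib_right mult.assoc)
qed

text \<open>
  Each pair of opposite off-diagonals of a symmetric array contributes twice the same sum. In the
  induction step the new row and column meet every diagonal in one more entry.
\<close>

lemma sum_square_by_diagonals:
  fixes h :: "nat \<Rightarrow> nat \<Rightarrow> 'a::comm_ring_1"
  assumes sym: "\<And>j l. h j l = h l j"
  shows "(\<Sum>j<s. \<Sum>l<s. h j l) =
    (\<Sum>m<s. (if m = 0 then 1 else 2) * (\<Sum>j<s - m. h j (j + m)))"
proof (induction s)
  case 0
  show ?case by simp
next
  case (Suc s)
  define w :: "nat \<Rightarrow> 'a" where "w m = (if m = 0 then 1 else 2)" for m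
  have "(\<Sum>m<Suc s. w m * (\<Sum>j<Suc s - m. h j (j + m)))
      = (\<Sum>m<Suc s. w m * (\<Sum>j<s - m. h j (j + m)) + w m * h (s - m) s)"
    by (intro sum.cong refl) (simp add: Suc_diff_le distrib_left)
  also have "\<dots> = (\<Sum>m<s. w m * (\<Sum>j<s - m. h j (j + m))) + (\<Sum>m<Suc s. w m * h (s - m) s)"
    by (simp add: sum.distrib)
  also have "(\<Sum>m<Suc s. w m * h (s - m) s) = h s s + 2 * (\<Sum>m<s. h (s - Suc m) s)"
    unfolding sum.lessThan_Suc_shift by (simp add: w_def sum_distrib_left)
  also have "(\<Sum>m<s. h (s - Suc m) s) = (\<Sum>j<s. h j s)"
    by (rule sum.nat_diff_reindex)
  also have "(\<Sum>m<s. w m * (\<Sum>j<s - m. h j (j + m))) = (\<Sum>j<s. \<Sum>l<s. h j l)"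
    using Suc.IH by (simp add: w_def)
  also have "(\<Sum>j<s. \<Sum>l<s. h j l) + (h s s + 2 * (\<Sum>j<s. h j s))
      = (\<Sum>j<Suc s. \<Sum>l<Suc s. h j l)"
  proof -
    have "(\<Sum>l<s. h s l) = (\<Sum>j<s. h j s)"
      by (intro sum.cong refl sym)
    then show ?thesis
      by (simp add: sum.distrib)
  qed
  finally show ?case
    by (simp add: w_def)
qed

text \<open>
  Expanding the square gives the symmetric array \<open>a\<^sub>j a\<^sub>l cos ((j - l) \<theta>)\<close>, in which the cosine is
  constant along diagonals. Collecting these leaves the autocorrelations of \<open>a\<close> as the coefficients of
  a cosine polynomial, so that for given numbers \<open>a\<^sub>j\<close> they can be evaluated before any cosine is
  involved.
\<close>

lemma cmod_trigonometric_sum_squared: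
  fixes a :: "nat \<Rightarrow> real"
  shows "(cmod (\<Sum>j<s. complex_of_real (a j) * cis (real j * \<theta>)))\<^sup>2 =
    (\<Sum>m<s. (if m = 0 then 1 else 2) * (\<Sum>j<s - m. a j * a (j + m)) * cos (real m * \<theta>))"
proof -
  define h where "h j l = a j * a l * cos ((real j - real l) * \<theta>)" for j l
  have sym: "h j l = h l j" for j l
  proof -
    have "cos ((real j - real l) * \<theta>) = cos (- ((real l - real j) * \<theta>))"
      by (simp only: minus_mult_left minus_diff_eq)
    then show ?thesis
      by (simp add: h_def)
  qed
  have "(cmod (\<Sum>j<s. complex_of_real (a j) * cis (real j * \<theta>)))\<^sup>2 =
      (\<Sum>j<s. a j * cos (real j * \<theta>))\<^sup>2 + (\<Sum>j<s. a j * sin (real j * \<theta>))\<^sup>2"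
    by (simp add: cmod_power2)
  also have "\<dots> = (\<Sum>j<s. \<Sum>l<s. h j l)"
    unfolding power2_eq_square sum_product sum.distrib[symmetric]
    by (intro sum.cong refl) (simp add: h_def cos_diff algebra_simps)
  also have "\<dots> = (\<Sum>m<s. (if m = 0 then 1 else 2) * (\<Sum>j<s - m. h j (j + m)))"
    by (rule sum_square_by_diagonals) (rule sym)
  also have "\<dots> = (\<Sum>m<s. (if m = 0 then 1 else 2) * (\<Sum>j<s - m. a j * a (j + m)) * cos (real m * \<theta>))"
    by (simp add: h_def sum_distrib_right mult.assoc)
  finally show ?thesis .
qed

lemma mbdf_H_eq_cmod_symbol_squared:
  assumes "s \<in> {2, 3, 4, 5, 6}"
  shows "mbdf_H s \<omega> \<tau> = (cmod (mbdf_symbol s (\<omega> * \<tau>)))\<^sup>2"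
proof -
  consider "s = 2" | "s = 3" | "s = 4" | "s = 5" | "s = 6"
    using assms by auto
  then show ?thesis
  proof cases
    case 1
    show ?thesis
      unfolding 1 mbdf_symbol_def cmod_trigonometric_sum_squared
      by (simp add: mbdf_coeffs_def lessThan_nat_numeral lessThan_Suc,
          simp add: mbdf_H_def mult.assoc[of _ \<omega> \<tau>], argo)
  next
    case 2
    show ?thesis
      unfolding 2 mbdf_symbol_def cmod_trigonometric_sum_squared
      by (simp add: mbdf_coeffs_def lessThan_nat_numeral lessThan_Suc,
          simp add: mbdf_H_def mult.assoc[of _ \<omega> \<tau>], argo)
  next
    case 3
    show ?thesis
      unfolding 3 mbdf_symbol_def cmod_trigonometric_sum_squared
      by (simp add: mbdf_coeffs_def lessThan_nat_numeral lessThan_Suc,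
          simp add: mbdf_H_def mult.assoc[of _ \<omega> \<tau>], argo)
  next
    case 4
    show ?thesis
      unfolding 4 mbdf_symbol_def cmod_trigonometric_sum_squared
      by (simp add: mbdf_coeffs_def lessThan_nat_numeral lessThan_Suc,
          simp add: mbdf_H_def mult.assoc[of _ \<omega> \<tau>], argo)
  next
    case 5
    show ?thesis
      unfolding 5 mbdf_symbol_def cmod_trigonometric_sum_squared
      by (simp add: mbdf_coeffs_def lessThan_nat_numeral lessThan_Suc,
          simp add: mbdf_H_def mult.assoc[of _ \<omega> \<tau>], argo)
  qed
qed

section \<open>The symbol has no zeros on the unit circle\<close>

lemma cos_multiples:
  fixes x :: real
  shows "cos (2 * x) = 2 * cos x ^ 2 - 1"
    and "cos (3 * x) = 4 * cos x ^ 3 - 3 * cos x"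
    and "cos (4 * x) = 8 * cos x ^ 4 - 8 * cos x ^ 2 + 1"
    and "cos (5 * x) = 16 * cos x ^ 5 - 20 * cos x ^ 3 + 5 * cos x"
proof -
  have step: "cos (m * x + x) = 2 * cos x * cos (m * x) - cos (m * x - x)" for m
    by (simp add: cos_add cos_diff)
  show 2: "cos (2 * x) = 2 * cos x ^ 2 - 1"
    by (rule cos_double_cos)
  show 3: "cos (3 * x) = 4 * cos x ^ 3 - 3 * cos x"
    by (rule cos_treble_cos)
  have "cos (4 * x) = 2 * cos x * cos (3 * x) - cos (2 * x)"
    using step[of 3] by (simp add: algebra_simps)
  then show 4: "cos (4 * x) = 8 * cos x ^ 4 - 8 * cos x ^ 2 + 1"
    unfolding 2 3 by algebra
  have "cos (5 * x) = 2 * cos x * cos (4 * x) - cos (3 * x)"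
    using step[of 4] by (simp add: algebra_simps)
  then show "cos (5 * x) = 16 * cos x ^ 5 - 20 * cos x ^ 3 + 5 * cos x"
    unfolding 3 4 by algebra
qed

text \<open>Completing the square, after multiplication by \<open>4 a\<close>.\<close>

lemma positive_quadratic:
  fixes a b c y :: real
  assumes "0 < a" "b\<^sup>2 < 4 * a * c"
  shows "0 < a * y\<^sup>2 + b * y + c"
proof -
  have "0 < (2 * a * y + b)\<^sup>2 + (4 * a * c - b\<^sup>2)"
    using assms by (intro add_nonneg_pos) auto
  also have "\<dots> = 4 * a * (a * y\<^sup>2 + b * y + c)"
    by (simp add: algebra_simps power2_eq_square)
  finally show ?thesis
    using assms by (simp add: zero_less_mult_iff)
qed

text \<open>
  In \<open>y = 1 - cos \<theta>\<close> the polynomials have constant term \<open>1\<close>, because the coefficients of each scheme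
  sum to \<open>1\<close>. Wherever a negative coefficient occurs, positivity on \<open>y \<ge> 0\<close> comes from splitting off
  nonnegative terms, such as \<open>y\<close> times a square, so that the only other ingredient is a quadratic with
  negative discriminant.
\<close>

lemma mbdf_H_pos:
  assumes "s \<in> {2, 3, 4, 5, 6}"
  shows "0 < mbdf_H s \<omega> \<tau>"
proof -
  define y where "y = 1 - cos (\<omega> * \<tau>)"
  have y: "0 \<le> y"
    by (simp add: y_def)
  have c: "cos (\<omega> * \<tau>) = 1 - y"
    by (simp add: y_def)
  consider "s = 2" | "s = 3" | "s = 4" | "s = 5" | "s = 6"
    using assms by auto
  then show ?thesis
  proof cases
    case 1
    then have "mbdf_H s \<omega> \<tau> = 1 + 3/2 * y"
      by (simp add: mbdf_H_def c field_simps)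
    then show ?thesis
      using y by simp
  next
    case 2
    have "mbdf_H s \<omega> \<tau> = 22/9 * y\<^sup>2 + 1/6 * y + 1"
      unfolding 2 mbdf_H_def mult.assoc[of _ \<omega> \<tau>] cos_multiples c
      by (simp add: field_simps power2_eq_square)
    also have "\<dots> > 0"
      by (rule positive_quadratic) (auto simp: power2_eq_square)
    finally show ?thesis .
  next
    case 3
    have "mbdf_H s \<omega> \<tau> = y * (25/6 * y\<^sup>2 + (-14/9) * y + 1/6) + 1"
      unfolding 3 mbdf_H_def mult.assoc[of _ \<omega> \<tau>] cos_multiples c
      by (simp, algebra)
    also have "\<dots> > 0"
      using y positive_quadratic[of "25/6" "-14/9" "1/6" y]
      by (intro add_nonneg_pos mult_nonneg_nonneg) (auto simp: power2_eq_square)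
    finally show ?thesis .
  next
    case 4
    \<comment> \<open>The square has the leading coefficient of \<open>H\<close>. Its linear coefficient overshoots the cubic term
      slightly, which leaves a positive multiple of \<open>y ^ 3\<close> and allows a short fraction. The constant
      \<open>1/5\<close> is chosen to give the remaining quadratic a negative discriminant.\<close>
    have "mbdf_H s \<omega> \<tau> = 548/75 * (y\<^sup>2 - 2/5 * y - 1/5)\<^sup>2 + 109/750 * y ^ 3
        + (10114/5625 * y\<^sup>2 + (-1253/1250) * y + 1327/1875)"
      unfolding 4 mbdf_H_def mult.assoc[of _ \<omega> \<tau>] cos_multiples c
      by (simp, algebra)
    also have "\<dots> > 0"
      using y by (intro add_nonneg_pos add_nonneg_nonneg positive_quadratic)
        (auto simp: power2_eq_square)
    finally show ?thesis .
  next
    case 5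
    \<comment> \<open>On \<open>y \<ge> 0\<close> the minimum of \<open>H\<close>, about \<open>0.33\<close>, lies near \<open>y = 4/5\<close>. All three squares
      vanish at this point, so the quadratic that is left agrees with \<open>H\<close> there. Their weights remove
      the powers \<open>y ^ 5\<close>, \<open>y ^ 4\<close> and \<open>y ^ 3\<close> in turn.\<close>
    have "mbdf_H s \<omega> \<tau> = 196/15 * (y * (y\<^sup>2 - 3/5 * y - 4/25)\<^sup>2)
        + 8/25 * (y * (y - 4/5))\<^sup>2 + 1717/750 * (y * (y - 4/5)\<^sup>2)
        + (1118/1125 * y\<^sup>2 + (-30619/18750) * y + 1)"
      unfolding 5 mbdf_H_def mult.assoc[of _ \<omega> \<tau>] cos_multiples c
      by (simp, algebra)
    also have "\<dots> > 0"
      using y by (intro add_nonneg_pos add_nonneg_nonneg positive_quadratic)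
        (auto simp: power2_eq_square)
    finally show ?thesis .
  qed
qed

section \<open>Substituting the plane wave\<close>

text \<open>
  Both sides are the common factor \<open>cis (- \<theta>/2)\<close> times a real number: a step of phase \<open>- \<theta>\<close> is
  symmetric about its midpoint.
\<close>

lemma crank_nicolson_phase_iff:
  fixes \<tau> \<theta> q :: real
  shows "\<i> / complex_of_real \<tau> * (cis (- \<theta>) - 1) = complex_of_real q * ((cis (- \<theta>) + 1) / 2) \<longleftrightarrow>
    2 / \<tau> * sin (\<theta> / 2) = q * cos (\<theta> / 2)"
proof -
  define w where "w = cis (- (\<theta> / 2))"
  have w: "w \<noteq> 0" "cis (- \<theta>) = w * w" "w * cis (\<theta> / 2) = 1"
    by (simp_all add: w_def cis_mult)
  have diff: "w * w - 1 = w * (- 2 * \<i> * complex_of_real (sin (\<theta> / 2)))"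
  proof -
    have "w * w - 1 = w * (w - cis (\<theta> / 2))"
      by (simp add: right_diff_distrib w(3))
    also have "w - cis (\<theta> / 2) = - 2 * \<i> * complex_of_real (sin (\<theta> / 2))"
      by (simp add: w_def complex_eq_iff)
    finally show ?thesis .
  qed
  have sum: "w * w + 1 = w * (2 * complex_of_real (cos (\<theta> / 2)))"
  proof -
    have "w * w + 1 = w * (w + cis (\<theta> / 2))"
      by (simp add: distrib_left w(3))
    also have "w + cis (\<theta> / 2) = 2 * complex_of_real (cos (\<theta> / 2))"
      by (simp add: w_def complex_eq_iff)
    finally show ?thesis .
  qed
  have "\<i> / complex_of_real \<tau> * (cis (- \<theta>) - 1) = w * complex_of_real (2 / \<tau> * sin (\<theta> / 2))"
    unfolding w(2) diff by (simp add: field_simps)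
  moreover have "complex_of_real q * ((cis (- \<theta>) + 1) / 2) = w * complex_of_real (q * cos (\<theta> / 2))"
    unfolding w(2) sum by simp
  ultimately show ?thesis
    using w(1) by (simp only: mult_cancel_left of_real_eq_iff simp_thms)
qed

lemma plane_wave_solves_mbdf_iff:
  fixes k :: "'a::euclidean_space"
  assumes symbol: "mbdf_symbol s (\<omega> * \<tau>) \<noteq> 0"
  shows "mbdf_scheme lam s \<tau> (discrete_plane_wave k \<omega> \<tau>) \<longleftrightarrow>
    2 / \<tau> * sin (\<omega> * \<tau> / 2) =
      ((norm k)\<^sup>2 + lam * (cmod (mbdf_symbol s (\<omega> * \<tau>)))\<^sup>2) * cos (\<omega> * \<tau> / 2)"
proof -
  let ?u = "discrete_plane_wave k \<omega> \<tau>"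
  define \<theta> where "\<theta> = \<omega> * \<tau>"
  define P where "P = mbdf_symbol s \<theta>"
  define q where "q = (norm k)\<^sup>2 + lam * (cmod P)\<^sup>2"
  define A where "A n x = P * cis (- (real n * \<theta>)) * exp (\<i> * complex_of_real (k \<bullet> x))" for n x
  have A_nz: "A n x \<noteq> 0" for n x
    using symbol by (simp add: A_def P_def \<theta>_def)
  have norm_A: "cmod (A n x) = cmod P" for n x
    by (simp add: A_def norm_mult)
  have A_Suc: "A (Suc n) x = cis (- \<theta>) * A n x" for n x
  proof -
    have "cis (- (real (Suc n) * \<theta>)) = cis (- \<theta>) * cis (- (real n * \<theta>))"
      by (simp add: cis_mult algebra_simps)
    then show ?thesis
      by (simp add: A_def)
  qed
  have R: "mbdf_R s ?u n = A n" if "s - 1 \<le> n" for n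
    by (rule ext) (simp add: mbdf_R_plane_wave[OF that] A_def P_def \<theta>_def)
  have equation_iff:
    "\<i> / complex_of_real \<tau> * (mbdf_R s ?u (Suc n) x - mbdf_R s ?u n x)
      = - laplacian (mbdf_R_half s ?u n) x
        + complex_of_real (lam / 2 * ((cmod (mbdf_R s ?u (Suc n) x))\<^sup>2 + (cmod (mbdf_R s ?u n x))\<^sup>2))
          * mbdf_R_half s ?u n x
    \<longleftrightarrow> 2 / \<tau> * sin (\<theta> / 2) = q * cos (\<theta> / 2)" if n: "s - 1 \<le> n" for n x
  proof -
    have n': "s - 1 \<le> Suc n"
      using n by simp
    have half_A: "mbdf_R_half s ?u n x = (cis (- \<theta>) + 1) / 2 * A n x" for x
      by (simp add: mbdf_R_half_def R[OF n] R[OF n'] A_Suc distrib_right)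
    have half: "mbdf_R_half s ?u n =
        (\<lambda>x. (cis (- \<theta>) + 1) / 2 * (P * cis (- (real n * \<theta>))) * exp (\<i> * complex_of_real (k \<bullet> x)))"
      by (rule ext) (simp only: half_A A_def mult.assoc)
    have lap: "laplacian (mbdf_R_half s ?u n) x =
        - complex_of_real ((norm k)\<^sup>2) * ((cis (- \<theta>) + 1) / 2 * A n x)"
      unfolding half laplacian_plane_wave by (simp only: A_def mult.assoc)
    have q: "complex_of_real q = complex_of_real ((norm k)\<^sup>2)
        + complex_of_real (lam / 2 * ((cmod P)\<^sup>2 + (cmod P)\<^sup>2))"
      by (simp add: q_def)
    have "- laplacian (mbdf_R_half s ?u n) x
        + complex_of_real (lam / 2 * ((cmod (mbdf_R s ?u (Suc n) x))\<^sup>2 + (cmod (mbdf_R s ?u n x))\<^sup>2))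
          * mbdf_R_half s ?u n x
        = complex_of_real q * ((cis (- \<theta>) + 1) / 2) * A n x"
      unfolding lap half_A R[OF n] R[OF n'] norm_A unfolding q
      by (simp only: distrib_right mult_minus_left minus_minus mult.assoc)
    moreover have "\<i> / complex_of_real \<tau> * (mbdf_R s ?u (Suc n) x - mbdf_R s ?u n x)
        = \<i> / complex_of_real \<tau> * (cis (- \<theta>) - 1) * A n x"
      unfolding R[OF n] R[OF n'] A_Suc by (simp add: algebra_simps)
    ultimately show ?thesis
      using crank_nicolson_phase_iff[of \<tau> \<theta> q] A_nz[of n x]
      by (simp only: mult_cancel_right simp_thms)
  qed
  have "mbdf_scheme lam s \<tau> ?u \<longleftrightarrow> 2 / \<tau> * sin (\<theta> / 2) = q * cos (\<theta> / 2)"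
    unfolding mbdf_scheme_def using equation_iff by blast
  then show ?thesis
    by (simp add: q_def P_def \<theta>_def)
qed

theorem lemma6p3:
  fixes lam \<tau> :: real and s :: nat
  assumes "lam = 1 \<or> lam = -1"
    and "\<tau> > 0"
    and "s \<in> {2, 3, 4, 5, 6}"
  shows "numerical_dispersion_relation (mbdf_scheme lam s) \<tau> =
    {(k :: 'a::euclidean_space, \<omega>).
      2 / \<tau> * sin (\<omega> * \<tau> / 2) = ((norm k)\<^sup>2 + lam * mbdf_H s \<omega> \<tau>) * cos (\<omega> * \<tau> / 2)}"
proof -
  have "mbdf_symbol s (\<omega> * \<tau>) \<noteq> 0" for \<omega>
    using mbdf_H_pos[OF assms(3), of \<omega> \<tau>] mbdf_H_eq_cmod_symbol_squared[OF assms(3), of \<omega> \<tau>]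
    by auto
  then show ?thesis
    unfolding numerical_dispersion_relation_def mbdf_H_eq_cmod_symbol_squared[OF assms(3)]
    using plane_wave_solves_mbdf_iff by blast
qed

end
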